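(* Let $n\in\mathbb N$, $k\in\{1,\dots,n\}$, $\tau>0$, $\mu\in\mathbb R^n$, let $A\in\mathbb R^{n\times n}$ be symmetric positive semidefinite, and let $\rho>0$. Let $\{(x_l,y_l)\}_{l\ge 1}$ be a sequence generated by the block coordinate descent (BCD) algorithm (described in the context) for the nonconvex problem $$(P_{x,y})\qquad\min_{x,y\in\mathbb R^n}\ q_\rho(x,y)\quad\text{subject to}\quad x\in\mathcal X,\ y\in\mathcal Y .$$ If $(x_*,y_* )$ is an accumulation point of this sequence, then $(x_*,y_* )$ is a saddle point of $(P_{x,y})$. Additionally, the sequence $\{q_\rho(x_l,y_l)\}$ is non-increasing, and if $q_\rho(x_r,y_r)=q_\rho(x_{r+1},y_{r+1})$ for some $r\in\mathbb N$ ($r\ge 1$), then $(x_r,y_r)$ is a saddle point of $(P_{x,y})$.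
   Context: Notation: $e\in\mathbb R^n$ is the all-ones vector; $\|y\|_0$ is the number of nonzero entries of $y$; inequalities between vectors are entrywise. $$q_\rho(x,y)=x^TAx-\tau\mu^Tx+\rho\|x-y\|_2^2,\qquad \mathcal X=\{x\in\mathbb R^n:e^Tx=1\},\qquad \mathcal Y=\{y\in\mathbb R^n:y\ge 0,\ \|y\|_0\le k\}.$$ A saddle point of $(P_{x,y})$ is a pair $(x_*,y_* )$ with $x_*\in\operatorname{Argmin}_{x\in\mathcal X}q_\rho(x,y_* )$ and $y_*\in\operatorname{Argmin}_{y\in\mathcal Y}q_\rho(x_*,y)$. BCD algorithm: choose an arbitrary $y_0\in\mathcal Y$; for $l=0,1,2,\dots$ let $x_{l+1}$ be the (unique) minimizer of $q_\rho(\cdot,y_l)$ over $\mathcal X$, and let $y_{l+1}$ be any element of $\operatorname{Argmin}_{y\in\mathcal Y}q_\rho(x_{l+1},y)$. The iteration is run indefinitely. *)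

theory Defs
  imports "HOL-Analysis.Analysis"
begin

definition Argmin :: "('a \<Rightarrow> real) \<Rightarrow> 'a set \<Rightarrow> 'a set" where
  "Argmin f S = {z. is_arg_min f (\<lambda>w. w \<in> S) z}"

definition pos_semidef :: "real ^ 'n ^ 'n \<Rightarrow> bool" where
  "pos_semidef A \<longleftrightarrow> (\<forall>v. 0 \<le> v \<bullet> (A *v v))"

definition norm0 :: "real ^ 'n \<Rightarrow> nat" where
  "norm0 y = card {i. y $ i \<noteq> 0}"

definition q :: "real ^ 'n ^ 'n \<Rightarrow> real \<Rightarrow> real ^ 'n \<Rightarrow> real
    \<Rightarrow> real ^ 'n \<Rightarrow> real ^ 'n \<Rightarrow> real" where
  "q A \<tau> \<mu> \<rho> x y = x \<bullet> (A *v x) - \<tau> * (\<mu> \<bullet> x) + \<rho> * (norm (x - y))\<^sup>2"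

definition X_set :: "(real ^ 'n) set" where
  "X_set = {x. (\<chi> i. 1) \<bullet> x = 1}"

text \<open>The order \<open>\<le>\<close> on \<open>real ^ 'n\<close> is the entrywise one.\<close>

definition Y_set :: "nat \<Rightarrow> (real ^ 'n) set" where
  "Y_set k = {y. 0 \<le> y \<and> norm0 y \<le> k}"

definition saddle_point :: "real ^ 'n ^ 'n \<Rightarrow> real \<Rightarrow> real ^ 'n \<Rightarrow> real \<Rightarrow> nat
    \<Rightarrow> (real ^ 'n) \<times> (real ^ 'n) \<Rightarrow> bool" where
  "saddle_point A \<tau> \<mu> \<rho> k = (\<lambda>(xs, ys).
     xs \<in> Argmin (\<lambda>x. q A \<tau> \<mu> \<rho> x ys) X_set \<and>
     ys \<in> Argmin (\<lambda>y. q A \<tau> \<mu> \<rho> xs y) (Y_set k))"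

text \<open>The algorithm has no iterate \<open>x\<^sub>0\<close>, so \<open>x 0\<close> is unconstrained and the generated
  sequence of pairs starts at index 1.\<close>

definition BCD :: "real ^ 'n ^ 'n \<Rightarrow> real \<Rightarrow> real ^ 'n \<Rightarrow> real \<Rightarrow> nat
    \<Rightarrow> (nat \<Rightarrow> real ^ 'n) \<Rightarrow> (nat \<Rightarrow> real ^ 'n) \<Rightarrow> bool" where
  "BCD A \<tau> \<mu> \<rho> k x y \<longleftrightarrow>
     y 0 \<in> Y_set k \<and>
     (\<forall>l. x (Suc l) \<in> Argmin (\<lambda>u. q A \<tau> \<mu> \<rho> u (y l)) X_set \<and>
          y (Suc l) \<in> Argmin (\<lambda>v. q A \<tau> \<mu> \<rho> (x (Suc l)) v) (Y_set k))"

text \<open>Accumulation points of a sequence are limits of subsequences; a value taken infinitely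
  often counts, even if it is not a limit point of the range.\<close>

definition accumulation_point :: "(nat \<Rightarrow> 'a::metric_space) \<Rightarrow> 'a \<Rightarrow> bool" where
  "accumulation_point s z \<longleftrightarrow> (\<exists>\<phi>. strict_mono \<phi> \<and> (s \<circ> \<phi>) \<longlonglongrightarrow> z)"

end

theory Submission
  imports Defs
begin

text \<open>
  Each half-step of the descent minimises one block, so the values \<open>f (x l) (y l)\<close> decrease. If
  two consecutive values agree, then \<open>x r\<close> already attains the minimum of \<open>f (\<cdot>, y r)\<close> that
  \<open>x (Suc r)\<close> attains. Along a subsequence converging to \<open>(a, b)\<close>, monotonicity bounds the value
  at the next index of the subsequence by \<open>f u (y l)\<close> at the current one, and optimality in the
  limit follows from continuity and closedness.
\<close>

lemma Argmin_iff: "z \<in> Argmin f S \<longleftrightarrow> z \<in> S \<and> (\<forall>w\<in>S. f z \<le> f w)"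
  by (auto simp: Argmin_def is_arg_min_linorder)

text \<open>Exact alternating minimisation for a general \<open>f\<close>. Descent and stationarity
  come from the minimiser properties alone; topology enters with the accumulation points.\<close>

locale block_descent =
  fixes f :: "'a::metric_space \<Rightarrow> 'b::metric_space \<Rightarrow> real"
    and X :: "'a set" and Y :: "'b set"
    and x :: "nat \<Rightarrow> 'a" and y :: "nat \<Rightarrow> 'b"
  assumes y0: "y 0 \<in> Y"
    and x_step: "x (Suc l) \<in> Argmin (\<lambda>u. f u (y l)) X"
    and y_step: "y (Suc l) \<in> Argmin (f (x (Suc l))) Y"
begin

lemma x_mem: "x (Suc l) \<in> X"
  using x_step by (simp add: Argmin_iff)

lemma y_mem: "y l \<in> Y"
  using y0 y_step by (cases l) (auto simp: Argmin_iff)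

lemma x_le: "u \<in> X \<Longrightarrow> f (x (Suc l)) (y l) \<le> f u (y l)"
  using x_step by (simp add: Argmin_iff)

lemma y_le: "v \<in> Y \<Longrightarrow> f (x (Suc l)) (y (Suc l)) \<le> f (x (Suc l)) v"
  using y_step by (simp add: Argmin_iff)

text \<open>The old \<open>y l\<close> competes in the \<open>y\<close>-step, and
  \<open>x (Suc l)\<close> is optimal against it. Keeping \<open>u\<close> arbitrary yields descent
  for \<open>u = x l\<close> and optimality tests otherwise.\<close>

lemma step_le: "u \<in> X \<Longrightarrow> f (x (Suc l)) (y (Suc l)) \<le> f u (y l)"
  using y_le[OF y_mem, of l l] x_le[of u l] by linarith

lemma decseq_value: "decseq (\<lambda>l. f (x (Suc l)) (y (Suc l)))"
  by (intro decseq_SucI step_le x_mem)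

text \<open>By \<open>step_le\<close> the later value bounds \<open>f u (y (Suc l))\<close> from
  below on \<open>X\<close>; the equality hands this bound to the current value.\<close>

lemma stationary_Argmin:
  assumes "f (x (Suc l)) (y (Suc l)) = f (x (Suc (Suc l))) (y (Suc (Suc l)))"
  shows "x (Suc l) \<in> Argmin (\<lambda>u. f u (y (Suc l))) X"
  using assms step_le[of _ "Suc l"] x_mem by (auto simp: Argmin_iff)

lemma accumulation_point_Argmin:
  assumes cont: "continuous_on UNIV (\<lambda>(u, v). f u v)" and "closed X" "closed Y"
    and acc: "accumulation_point (\<lambda>l. (x (Suc l), y (Suc l))) (a, b)"
  shows "a \<in> Argmin (\<lambda>u. f u b) X" and "b \<in> Argmin (f a) Y"
proof -
  from acc obtain \<phi> where mono: "strict_mono \<phi>"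
    and lim: "(\<lambda>j. (x (Suc (\<phi> j)), y (Suc (\<phi> j)))) \<longlonglongrightarrow> (a, b)"
    by (auto simp: accumulation_point_def o_def)
  have xlim: "(\<lambda>j. x (Suc (\<phi> j))) \<longlonglongrightarrow> a" and ylim: "(\<lambda>j. y (Suc (\<phi> j))) \<longlonglongrightarrow> b"
    using tendsto_fst[OF lim] tendsto_snd[OF lim] by simp_all
  have flim: "(\<lambda>j. f (s j) (t j)) \<longlonglongrightarrow> f c d" if "s \<longlonglongrightarrow> c" "t \<longlonglongrightarrow> d" for s t c d
    using continuous_on_tendsto_compose[OF cont tendsto_Pair[OF that]] by simp
  have vlim: "(\<lambda>j. f (x (Suc (\<phi> j))) (y (Suc (\<phi> j)))) \<longlonglongrightarrow> f a b"
    by (rule flim[OF xlim ylim])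
  have "a \<in> X" "b \<in> Y"
    using closed_sequentially[OF \<open>closed X\<close> x_mem xlim]
      closed_sequentially[OF \<open>closed Y\<close> y_mem ylim] by auto
  moreover have "f a b \<le> f u b" if "u \<in> X" for u
  \<comment> \<open>The values are shifted by one term: \<open>y (Suc (\<phi> j))\<close> constrains
    later iterates, and \<open>\<phi> (Suc j)\<close> lies at least one full iteration further
    on.\<close>
  proof (rule LIMSEQ_le[OF LIMSEQ_Suc[OF vlim] flim[OF tendsto_const ylim]], intro exI allI impI)
    fix j
    have "Suc (\<phi> j) \<le> \<phi> (Suc j)"
      using mono by (simp add: strict_mono_Suc_iff Suc_leI)
    then have "f (x (Suc (\<phi> (Suc j)))) (y (Suc (\<phi> (Suc j))))
        \<le> f (x (Suc (Suc (\<phi> j)))) (y (Suc (Suc (\<phi> j))))"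
      by (rule decseqD[OF decseq_value])
    also have "\<dots> \<le> f u (y (Suc (\<phi> j)))"
      by (rule step_le[OF that])
    finally show "f (x (Suc (\<phi> (Suc j)))) (y (Suc (\<phi> (Suc j)))) \<le> f u (y (Suc (\<phi> j)))" .
  qed
  moreover have "f a b \<le> f a v" if "v \<in> Y" for v
    \<comment> \<open>No shift here: \<open>y (Suc l)\<close> is optimal against
      \<open>x (Suc l)\<close> of the same index.\<close>
    by (rule LIMSEQ_le[OF vlim flim[OF xlim tendsto_const]]) (use y_le[OF that] in auto)
  ultimately show "a \<in> Argmin (\<lambda>u. f u b) X" and "b \<in> Argmin (f a) Y"
    by (auto simp: Argmin_iff)
qed

end

lemma continuous_on_q: "continuous_on UNIV (\<lambda>(x, y). q A \<tau> \<mu> \<rho> x y)"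
  unfolding q_def case_prod_unfold
  by (intro continuous_intros linear_continuous_on_compose[OF _ matrix_vector_mul_linear])

lemma closed_X_set: "closed X_set"
  unfolding X_set_def by (intro closed_Collect_eq continuous_intros)

text \<open>Although \<open>norm0\<close> is discontinuous, this set is a finite union of coordinate
  subspaces, one for each index set \<open>S\<close> of size at most \<open>k\<close>.\<close>

lemma closed_norm0_le: "closed {y :: real ^ 'n. norm0 y \<le> k}"
proof -
  have "{y :: real ^ 'n. norm0 y \<le> k}
      = (\<Union>S\<in>{S. card S \<le> k}. {y. \<forall>i. i \<in> - S \<longrightarrow> y $ i = 0})"
  proof (intro equalityI subsetI)
    fix y :: "real ^ 'n"
    assume "y \<in> (\<Union>S\<in>{S. card S \<le> k}. {y. \<forall>i. i \<in> - S \<longrightarrow> y $ i = 0})"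
    then obtain S where "card S \<le> k" "{i. y $ i \<noteq> 0} \<subseteq> S"
      by auto
    then show "y \<in> {y. norm0 y \<le> k}"
      using card_mono[of S "{i. y $ i \<noteq> 0}"] by (simp add: norm0_def)
  qed (auto simp: norm0_def)
  moreover have "closed \<dots>"
    by (intro closed_UN ballI closed_Collect_all closed_Collect_imp open_Collect_const
        closed_Collect_eq continuous_intros) auto
  ultimately show ?thesis
    by simp
qed

lemma closed_Y_set: "closed (Y_set k :: (real ^ 'n) set)"
proof -
  have "closed {y :: real ^ 'n. 0 \<le> y}"
    unfolding less_eq_vec_def by (intro closed_Collect_all closed_Collect_le continuous_intros)
  then show ?thesis
    unfolding Y_set_def using closed_norm0_le by (rule closed_Collect_conj)
qed

theorem theorem2p1:
  fixes A :: "real ^ 'n ^ 'n" and \<mu> :: "real ^ 'n"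
    and \<tau> \<rho> :: real and k :: nat
    and x y :: "nat \<Rightarrow> real ^ 'n"
  assumes "1 \<le> k" and "k \<le> CARD('n)"
    and "\<tau> > 0" and "\<rho> > 0"
    and "transpose A = A" and "pos_semidef A"
    and "BCD A \<tau> \<mu> \<rho> k x y"
  shows "(\<forall>xs ys. accumulation_point (\<lambda>l. (x (Suc l), y (Suc l))) (xs, ys)
            \<longrightarrow> saddle_point A \<tau> \<mu> \<rho> k (xs, ys))
       \<and> (\<forall>l\<ge>1. q A \<tau> \<mu> \<rho> (x (Suc l)) (y (Suc l)) \<le> q A \<tau> \<mu> \<rho> (x l) (y l))
       \<and> (\<forall>r\<ge>1. q A \<tau> \<mu> \<rho> (x r) (y r) = q A \<tau> \<mu> \<rho> (x (Suc r)) (y (Suc r))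
            \<longrightarrow> saddle_point A \<tau> \<mu> \<rho> k (x r, y r))"
proof -
  interpret block_descent "q A \<tau> \<mu> \<rho>" X_set "Y_set k" x y
    using \<open>BCD A \<tau> \<mu> \<rho> k x y\<close> by unfold_locales (auto simp: BCD_def)
  show ?thesis
  proof (intro conjI allI impI)
    fix xs ys
    assume "accumulation_point (\<lambda>l. (x (Suc l), y (Suc l))) (xs, ys)"
    then show "saddle_point A \<tau> \<mu> \<rho> k (xs, ys)"
      using accumulation_point_Argmin[OF continuous_on_q closed_X_set closed_Y_set]
      by (simp add: saddle_point_def)
  next
    fix l :: nat
    assume "1 \<le> l"
    then obtain m where "l = Suc m"
      by (cases l) auto
    then show "q A \<tau> \<mu> \<rho> (x (Suc l)) (y (Suc l)) \<le> q A \<tau> \<mu> \<rho> (x l) (y l)"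
      by (simp add: step_le x_mem)
  next
    fix r :: nat
    assume "1 \<le> r" and eq: "q A \<tau> \<mu> \<rho> (x r) (y r) = q A \<tau> \<mu> \<rho> (x (Suc r)) (y (Suc r))"
    then obtain m where "r = Suc m"
      by (cases r) auto
    \<comment> \<open>The \<open>y\<close>-half is \<open>y_step\<close> itself; the equality serves
      the \<open>x\<close>-half, as \<open>x (Suc m)\<close> was chosen against \<open>y m\<close>,
      not \<open>y (Suc m)\<close>.\<close>
    with eq show "saddle_point A \<tau> \<mu> \<rho> k (x r, y r)"
      using stationary_Argmin[of m] y_step[of m] by (simp add: saddle_point_def)
  qed
qed

end
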